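(* Let $k\in\mathbb N_+$ and $\theta\in[-1,1]$, and let $q_\star\in\mathbb P^{\lfloor k/2\rfloor}$ be the polynomial defined in the context. Let $\{g_i\}$ be a basis of $\mathbb P^k(\mathscr G_s)$. Suppose there exist $\{(\omega_s,x^{(s)},y^{(s)})\}_{s=1}^S$ with $\omega_s>0$ and $x^{(s)},y^{(s)}\in[0,1]$ satisfying $$\begin{cases}q_\star(x^{(s)},y^{(s)})=0,\qquad 1\le s\le S,\\[3pt] \displaystyle\langle g_i\rangle_\Omega=\phi^\star\big(\theta,(\mathbb P^{\lfloor k/2\rfloor})^2\big)\big[(1+\theta)\langle g_i\rangle_\Omega^x+(1-\theta)\langle g_i\rangle_\Omega^y\big]+\sum_{s=1}^S\omega_s\,\overline{g_i(x^{(s)},y^{(s)})},\quad 1\le i\le\dim\mathbb P^k(\mathscr G_s).\end{cases}$$ Then the symmetric CAD $$\langle p\rangle_\Omega=\phi^\star\big(\theta,(\mathbb P^{\lfloor k/2\rfloor})^2\big)\big[(1+\theta)\langle p\rangle_\Omega^x+(1-\theta)\langle p\rangle_\Omega^y\big]+\sum_{s=1}^S\omega_s\,\overline{p(x^{(s)},y^{(s)})}$$ is an OCAD for $\mathbb P^k$ and $\theta$. Furthermore, in this case $$\overline\omega_\star(\theta,\mathbb P^k)=\phi^\star(\theta,\mathbb P^k_+)=\phi^\star\big(\theta,(\mathbb P^{\lfloor k/2\rfloor})^2\big)=\phi(q_\star^2;\theta),$$ and $q_\star^2$ is a critical positive polynomial for $\phi^\star(\theta,\mathbb P^k_+)$.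
   Context: $\mathbb P^k$: real polynomials in $(x,y)$ of total degree at most $k$. $\mathbb P^k(\mathscr G_s)$ is the subspace of those $p\in\mathbb P^k$ invariant under $(x,y)\mapsto(\pm x,\pm y)$ for all sign choices (i.e. even in $x$ and even in $y$). $\Omega=[-1,1]^2$, $\langle p\rangle_\Omega=\frac14\iint_\Omega p$, $\langle p\rangle_\Omega^x=\frac14\int_{-1}^1[p(-1,y)+p(1,y)]dy$, $\langle p\rangle_\Omega^y=\frac14\int_{-1}^1[p(x,-1)+p(x,1)]dx$, $\overline{p(a,b)}=\frac14[p(a,b)+p(-a,b)+p(a,-b)+p(-a,-b)]$. A feasible symmetric CAD for $(\theta,\mathbb P^k)$ with boundary weight $\overline\omega$ is an identity $\langle p\rangle_\Omega=\overline\omega[(1+\theta)\langle p\rangle_\Omega^x+(1-\theta)\langle p\rangle_\Omega^y]+\sum_{s=1}^S\omega_s\overline{p(x^{(s)},y^{(s)})}$ valid for all $p\in\mathbb P^k$, with $S\ge0$ finite, $\overline\omega>0$, all $\omega_s>0$, all $(x^{(s)},y^{(s)})\in[0,1]^2$. $\overline\omega_\star(\theta,\mathbb P^k)$ is the maximum of $\overline\omega$ over all such CADs, and an OCAD is one attaining it. $\mathbb P^k_+=\{p\in\mathbb P^k:p\ge0\text{ on }\Omega\}$. For $p\in\mathbb P_+^k$, $\phi(p;\theta)=\dfrac{\langle p\rangle_\Omega}{(1+\theta)\langle p\rangle_\Omega^x+(1-\theta)\langle p\rangle_\Omega^y}$ if the denominator is nonzero, $+\infty$ otherwise; $\phi^\star(\theta,\mathbb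 P^k_+)=\inf_{p\in\mathbb P^k_+}\phi(p;\theta)$ and $\phi^\star(\theta,(\mathbb P^m)^2)=\inf_{q\in\mathbb P^m}\phi(q^2;\theta)$. A critical positive polynomial for $\phi^\star(\theta,\mathbb P^k_+)$ is a $p^\star\in\mathbb P^k_+\setminus\{0\}$ with $\phi(p^\star;\theta)=\phi^\star(\theta,\mathbb P^k_+)$. Definition of $q_\star$: let $\boldsymbol b=(b_1,\dots,b_D)^\top$ be the monomial basis of $\mathbb P^{\lfloor k/2\rfloor}$, $[\mathbf M_\Omega]_{ij}=\langle b_ib_j\rangle_\Omega$, $[\mathbf M_\Omega^x]_{ij}=\langle b_ib_j\rangle_\Omega^x$, $[\mathbf M_\Omega^y]_{ij}=\langle b_ib_j\rangle_\Omega^y$, $\mathbf M_\theta=(1+\theta)\mathbf M_\Omega^x+(1-\theta)\mathbf M_\Omega^y$ ($\mathbf M_\Omega$ is positive definite). Then $q_\star(x,y)=\widehat{\boldsymbol q}_\theta^\top\mathbf M_\Omega^{-1/2}\boldsymbol b(x,y)$, where $\widehat{\boldsymbol q}_\theta$ is an eigenvector of $\mathbf M_\Omega^{-1/2}\mathbf M_\theta\mathbf M_\Omega^{-1/2}$ for the eigenvalue equal to its spectral radius. *)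

theory Defs
  imports
    "Jordan_Normal_Form.Spectral_Radius"
    "HOL-Analysis.Analysis"
    "HOL-Library.Function_Algebras"
begin

text \<open>
  Bivariate real polynomials are represented by the functions on the plane that they induce
  (faithful, since the reals are infinite). The interpretation makes the linear-algebra notions
  \<open>bifun.span\<close>, \<open>bifun.independent\<close>, \<open>bifun.dim\<close> available for the
  pointwise vector-space structure on these functions.
\<close>

type_synonym bifun = "real \<times> real \<Rightarrow> real"

definition scale_bifun :: "real \<Rightarrow> bifun \<Rightarrow> bifun" where
  "scale_bifun c f = (\<lambda>z. c * f z)"

global_interpretation bifun: vector_space scale_bifun
  by unfold_locales (auto simp: scale_bifun_def fun_eq_iff algebra_simps)

definition mono2 :: "nat \<times> nat \<Rightarrow> bifun" where
  "mono2 e = (\<lambda>(x, y). x ^ fst e * y ^ snd e)"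

definition PP :: "nat \<Rightarrow> bifun set" where
  "PP k = bifun.span (mono2 ` {(i, j). i + j \<le> k})"

definition PP_sym :: "nat \<Rightarrow> bifun set" where
  "PP_sym k = {p \<in> PP k. \<forall>a \<in> {1, -1}. \<forall>b \<in> {1, -1}. \<forall>x y. p (a * x, b * y) = p (x, y)}"

definition Omega :: "(real \<times> real) set" where
  "Omega = {-1..1} \<times> {-1..1}"

definition PP_pos :: "nat \<Rightarrow> bifun set" where
  "PP_pos k = {p \<in> PP k. \<forall>z \<in> Omega. p z \<ge> 0}"

definition avg :: "bifun \<Rightarrow> real" where
  "avg p = 1/4 * integral Omega p"

definition avg_x :: "bifun \<Rightarrow> real" where
  "avg_x p = 1/4 * integral {-1..1} (\<lambda>y. p (-1, y) + p (1, y))"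

definition avg_y :: "bifun \<Rightarrow> real" where
  "avg_y p = 1/4 * integral {-1..1} (\<lambda>x. p (x, -1) + p (x, 1))"

definition avg_bd :: "real \<Rightarrow> bifun \<Rightarrow> real" where
  "avg_bd \<theta> p = (1 + \<theta>) * avg_x p + (1 - \<theta>) * avg_y p"

definition sym_avg :: "bifun \<Rightarrow> real \<Rightarrow> real \<Rightarrow> real" where
  "sym_avg p a b = 1/4 * (p (a, b) + p (-a, b) + p (a, -b) + p (-a, -b))"

text \<open>
  A CAD is given by its boundary weight \<open>w\<close>, the number \<open>S\<close> of internal nodes, and, for
  \<open>s \<in> {1..S}\<close>, the weights \<open>\<omega> s\<close> and nodes \<open>(x s, y s)\<close>.
\<close>

definition feasible_CAD ::
  "real \<Rightarrow> nat \<Rightarrow> real \<Rightarrow> nat \<Rightarrow> (nat \<Rightarrow> real) \<Rightarrow> (nat \<Rightarrow> real) \<Rightarrow> (nat \<Rightarrow> real) \<Rightarrow> bool" where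
  "feasible_CAD \<theta> k w S \<omega> x y \<longleftrightarrow>
     w > 0 \<and>
     (\<forall>s \<in> {1..S}. \<omega> s > 0 \<and> x s \<in> {0..1} \<and> y s \<in> {0..1}) \<and>
     (\<forall>p \<in> PP k. avg p = w * avg_bd \<theta> p + (\<Sum>s = 1..S. \<omega> s * sym_avg p (x s) (y s)))"

definition feasible_weights :: "real \<Rightarrow> nat \<Rightarrow> real set" where
  "feasible_weights \<theta> k = {w. \<exists>S \<omega> x y. feasible_CAD \<theta> k w S \<omega> x y}"

text \<open>
  The maximum; \<open>Max\<close> is not usable since the set of feasible weights need not be finite.
\<close>

definition omega_star :: "real \<Rightarrow> nat \<Rightarrow> real" where
  "omega_star \<theta> k = (GREATEST w. w \<in> feasible_weights \<theta> k)"

definition is_OCAD ::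
  "real \<Rightarrow> nat \<Rightarrow> real \<Rightarrow> nat \<Rightarrow> (nat \<Rightarrow> real) \<Rightarrow> (nat \<Rightarrow> real) \<Rightarrow> (nat \<Rightarrow> real) \<Rightarrow> bool" where
  "is_OCAD \<theta> k w S \<omega> x y \<longleftrightarrow>
     feasible_CAD \<theta> k w S \<omega> x y \<and> (\<forall>w' \<in> feasible_weights \<theta> k. w' \<le> w)"

definition phi :: "real \<Rightarrow> bifun \<Rightarrow> ereal" where
  "phi \<theta> p = (if avg_bd \<theta> p \<noteq> 0 then ereal (avg p / avg_bd \<theta> p) else \<infinity>)"

definition phi_star_pos :: "real \<Rightarrow> nat \<Rightarrow> ereal" where
  "phi_star_pos \<theta> k = (INF p \<in> PP_pos k. phi \<theta> p)"

definition phi_star_sq :: "real \<Rightarrow> nat \<Rightarrow> ereal" where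
  "phi_star_sq \<theta> m = (INF q \<in> PP m. phi \<theta> (\<lambda>z. (q z)\<^sup>2))"

definition critical_pos_poly :: "real \<Rightarrow> nat \<Rightarrow> bifun \<Rightarrow> bool" where
  "critical_pos_poly \<theta> k p \<longleftrightarrow> p \<in> PP_pos k \<and> p \<noteq> (\<lambda>z. 0) \<and> phi \<theta> p = phi_star_pos \<theta> k"

definition gram_mat :: "(bifun \<Rightarrow> real) \<Rightarrow> bifun list \<Rightarrow> real mat" where
  "gram_mat L bs = Matrix.mat (length bs) (length bs) (\<lambda>(i, j). L (\<lambda>z. (bs ! i) z * (bs ! j) z))"

definition pos_def_mat :: "nat \<Rightarrow> real mat \<Rightarrow> bool" where
  "pos_def_mat n A \<longleftrightarrow> A \<in> carrier_mat n n \<and> transpose_mat A = A \<and>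
     (\<forall>v \<in> carrier_vec n. v \<noteq> 0\<^sub>v n \<longrightarrow> scalar_prod v (A *\<^sub>v v) > 0)"

text \<open>
  \<open>R\<close> is the inverse square root of the positive definite matrix \<open>A\<close>, i.e. the unique
  positive definite \<open>R\<close> whose square is the inverse of \<open>A\<close>.
\<close>

definition is_inv_sqrt :: "nat \<Rightarrow> real mat \<Rightarrow> real mat \<Rightarrow> bool" where
  "is_inv_sqrt n A R \<longleftrightarrow> pos_def_mat n R \<and> inverts_mat A (R * R) \<and> inverts_mat (R * R) A"

text \<open>
  The polynomial \<open>q\<^sub>\<star>\<close> is determined only up to the choice of the eigenvector \<open>v\<close>,
  so it is described by a predicate; the order \<open>es\<close> in which the exponents of
  the monomials are listed is arbitrary. The library's spectral radius is that of a
  complex matrix.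
\<close>

definition is_q_star :: "real \<Rightarrow> nat \<Rightarrow> bifun \<Rightarrow> bool" where
  "is_q_star \<theta> m q \<longleftrightarrow>
     (\<exists>es bs R A v.
        distinct es \<and> set es = {(i, j). i + j \<le> m} \<and> bs = map mono2 es \<and>
        is_inv_sqrt (length bs) (gram_mat avg bs) R \<and>
        A = R * ((1 + \<theta>) \<cdot>\<^sub>m gram_mat avg_x bs + (1 - \<theta>) \<cdot>\<^sub>m gram_mat avg_y bs) * R \<and>
        eigenvector A v (spectral_radius (map_mat complex_of_real A)) \<and>
        q = (\<lambda>z. scalar_prod v (R *\<^sub>v Matrix.vec (length bs) (\<lambda>i. (bs ! i) z))))"

end

theory Submission
  imports Defs
begin

text \<open>
  In coordinates adapted to \<open>M\<^sub>\<Omega>\<close>, maximising \<open>\<langle>q\<^sup>2\<rangle>\<close> on the boundary against \<open>\<langle>q\<^sup>2\<rangle>\<close> on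
  \<open>\<Omega>\<close> is a Rayleigh quotient problem for the symmetric matrix
  \<open>M\<^sub>\<Omega>\<^sup>-\<^sup>1\<^sup>/\<^sup>2 M\<^sub>\<theta> M\<^sub>\<Omega>\<^sup>-\<^sup>1\<^sup>/\<^sup>2\<close>, so its maximum is the
  spectral radius and is attained at \<open>q\<^sub>\<star>\<close>; hence \<open>\<phi>\<^sup>\<star>\<close> over squares is the reciprocal of the
  spectral radius. Averaging over the four reflections extends the cubature identity from the
  symmetric polynomials to all of them, so \<open>\<phi>\<^sup>\<star>\<close> over squares is a feasible weight. Testing a
  feasible CAD against nonnegative polynomials bounds every feasible weight by \<open>\<phi>\<^sup>\<star>\<close> over
  nonnegative polynomials, which is at most \<open>\<phi>\<^sup>\<star>\<close> over squares, and the chain closes.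
\<close>

unbundle no vec_syntax
unbundle no inner_syntax

subsection \<open>Rayleigh quotients and the spectral radius\<close>

lemma scalar_prod_symmetric_mat:
  fixes A :: "real mat"
  assumes "A \<in> carrier_mat n n" "transpose_mat A = A" "u \<in> carrier_vec n" "w \<in> carrier_vec n"
  shows "u \<bullet> (A *\<^sub>v w) = (A *\<^sub>v u) \<bullet> w"
  using transpose_vec_mult_scalar[OF assms(1,4,3)] assms(2) by simp

lemma smult_mat_mult_vec:
  fixes A :: "'a::comm_ring_1 mat"
  assumes "A \<in> carrier_mat nr nc" "v \<in> carrier_vec nc"
  shows "(c \<cdot>\<^sub>m A) *\<^sub>v v = c \<cdot>\<^sub>v (A *\<^sub>v v)"
  using assms by (intro eq_vecI) (auto simp: scalar_prod_def sum_distrib_left mult.assoc)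

lemma transpose_smult_mat: "transpose_mat (c \<cdot>\<^sub>m A) = c \<cdot>\<^sub>m transpose_mat A"
  by (rule eq_matI) auto

lemma scalar_prod_self_pos:
  fixes v :: "real Matrix.vec"
  assumes "v \<in> carrier_vec n" "v \<noteq> 0\<^sub>v n"
  shows "v \<bullet> v > 0"
proof -
  obtain i where i: "i < n" "v $ i \<noteq> 0"
    using assms by (metis carrier_vecD eq_vecI index_zero_vec)
  have "(\<Sum>i\<in>{0..<n}. v $ i * v $ i) > 0"
    by (rule sum_pos2[of _ i]) (use i in \<open>auto simp: zero_less_mult_iff\<close>)
  then show ?thesis using assms(1) by (simp add: scalar_prod_def)
qed

lemma Cauchy_Schwarz_vec:
  fixes u w :: "real Matrix.vec"
  assumes "u \<in> carrier_vec n" "w \<in> carrier_vec n"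
  shows "(u \<bullet> w)\<^sup>2 \<le> (u \<bullet> u) * (w \<bullet> w)"
  using Cauchy_Schwarz_ineq_sum[of "vec_index u" "vec_index w" "{0..<n}"] assms
  by (simp add: scalar_prod_def power2_eq_square)

text \<open>An eigenvalue \<open>\<mu>\<close> of the scaled matrix makes \<open>t * \<mu>\<close>
  an eigenvalue of \<open>A\<close>, so \<open>t * cmod \<mu>\<close> is at most the radius of
  \<open>A\<close>, which is below \<open>t\<close>. The condition \<open>n > 0\<close> makes the
  spectrum nonempty, so the radius is attained.\<close>

lemma spectral_radius_smult_less_1:
  fixes A :: "complex mat"
  assumes A: "A \<in> carrier_mat n n" and n: "n > 0" and t: "t > spectral_radius A" "t > 0"
  shows "spectral_radius (complex_of_real (1 / t) \<cdot>\<^sub>m A) < 1"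
proof -
  let ?B = "complex_of_real (1 / t) \<cdot>\<^sub>m A"
  have B: "?B \<in> carrier_mat n n" using A by simp
  obtain \<mu> where \<mu>: "eigenvalue ?B \<mu>" "spectral_radius ?B = cmod \<mu>"
    using spectral_radius_mem_max(1)[OF B n] by (auto simp: spectrum_def)
  obtain v where v: "v \<in> carrier_vec n" "v \<noteq> 0\<^sub>v n" "?B *\<^sub>v v = \<mu> \<cdot>\<^sub>v v"
    using \<mu>(1) A unfolding eigenvalue_def eigenvector_def by auto
  have "complex_of_real (1 / t) \<cdot>\<^sub>v (A *\<^sub>v v) = \<mu> \<cdot>\<^sub>v v"
    using v(3) smult_mat_mult_vec[OF A v(1)] by metis
  then have "complex_of_real t \<cdot>\<^sub>v (complex_of_real (1 / t) \<cdot>\<^sub>v (A *\<^sub>v v))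
      = complex_of_real t \<cdot>\<^sub>v (\<mu> \<cdot>\<^sub>v v)" by simp
  then have "A *\<^sub>v v = (complex_of_real t * \<mu>) \<cdot>\<^sub>v v"
    using t by (simp add: smult_smult_assoc)
  then have "eigenvalue A (complex_of_real t * \<mu>)"
    using v A unfolding eigenvalue_def eigenvector_def by auto
  then have "cmod (complex_of_real t * \<mu>) \<le> spectral_radius A"
    by (intro spectral_radius_mem_max(2)[OF A n]) (auto simp: spectrum_def)
  then have "t * cmod \<mu> \<le> spectral_radius A" using t(2) by (simp add: norm_mult)
  then have "t * cmod \<mu> < t * 1" using t(1) by linarith
  then have "cmod \<mu> < 1" using t(2) by (simp only: mult_less_cancel_left_pos)
  then show ?thesis using \<mu>(2) by simp
qed

text \<open>Links the two views of the moments: boundedness is known for matrix powers, while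
  self-adjointness moves one factor at a time through iterates.\<close>

lemma pow_mat_mult_vec:
  fixes A :: "real mat"
  assumes "A \<in> carrier_mat n n" "w \<in> carrier_vec n"
  shows "A ^\<^sub>m k *\<^sub>v w = (((*\<^sub>v) A) ^^ k) w"
  using assms(2)
proof (induction k arbitrary: w)
  case 0
  then show ?case using assms(1) by simp
next
  case (Suc k)
  have "A ^\<^sub>m Suc k *\<^sub>v w = A ^\<^sub>m k *\<^sub>v (A *\<^sub>v w)"
    using assms(1) Suc.prems by (simp add: assoc_mult_mat_vec[of _ n n _ n])
  also have "\<dots> = (((*\<^sub>v) A) ^^ k) (A *\<^sub>v w)"
    by (rule Suc.IH) (use assms(1) Suc.prems in simp)
  finally show ?case by (simp add: funpow_swap1)
qed

text \<open>The Jordan normal form bounds the entries of all powers by one constant, and the form is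
  a fixed finite combination of these entries.\<close>

lemma quadratic_form_pow_bounded:
  fixes B :: "real mat"
  assumes B: "B \<in> carrier_mat n n" and w: "w \<in> carrier_vec n"
    and sr: "spectral_radius (map_mat complex_of_real B) < 1"
  shows "\<exists>C. \<forall>k. w \<bullet> (B ^\<^sub>m k *\<^sub>v w) \<le> C"
proof -
  obtain c where c: "\<And>k. norm_bound (map_mat complex_of_real B ^\<^sub>m k) c"
    using spectral_radius_jnf_norm_bound_less_1_upper_triangular[OF _ sr, of n] B by auto
  have "w \<bullet> (B ^\<^sub>m k *\<^sub>v w) \<le> (\<Sum>i<n. \<Sum>j<n. \<bar>w $ i\<bar> * (c * \<bar>w $ j\<bar>))" for k
  proof -
    have Bk: "B ^\<^sub>m k \<in> carrier_mat n n" using B by simp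
    have entry: "\<bar>(B ^\<^sub>m k) $$ (i, j)\<bar> \<le> c" if "i < n" "j < n" for i j
    proof -
      \<comment> \<open>The entry bound concerns the complex matrix; the embedding of the reals
        commutes with powers and preserves absolute values.\<close>
      have "map_mat complex_of_real B ^\<^sub>m k = map_mat complex_of_real (B ^\<^sub>m k)"
        by (rule of_real_hom.mat_hom_pow[OF B, symmetric])
      with c[of k] have "norm_bound (map_mat complex_of_real (B ^\<^sub>m k)) c" by simp
      then show ?thesis using that B Bk unfolding norm_bound_def by (auto split: if_splits)
    qed
    have "w \<bullet> (B ^\<^sub>m k *\<^sub>v w) = (\<Sum>i<n. \<Sum>j<n. w $ i * ((B ^\<^sub>m k) $$ (i, j) * w $ j))"
      using w carrier_matD[OF Bk]
      by (simp add: scalar_prod_def sum_distrib_left atLeast0LessThan del: pow_mat_dim)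
    also have "\<dots> \<le> (\<Sum>i<n. \<Sum>j<n. \<bar>w $ i\<bar> * (c * \<bar>w $ j\<bar>))"
    proof (intro sum_mono)
      fix i j assume "i \<in> {..<n}" "j \<in> {..<n}"
      then have "\<bar>w $ i * ((B ^\<^sub>m k) $$ (i, j) * w $ j)\<bar> \<le> \<bar>w $ i\<bar> * (c * \<bar>w $ j\<bar>)"
        unfolding abs_mult by (intro mult_left_mono mult_right_mono entry) auto
      then show "w $ i * ((B ^\<^sub>m k) $$ (i, j) * w $ j) \<le> \<bar>w $ i\<bar> * (c * \<bar>w $ j\<bar>)" by linarith
    qed
    finally show ?thesis .
  qed
  then show ?thesis by blast
qed

text \<open>
  If \<open>w \<bullet> B w > w \<bullet> w\<close>, then by Cauchy--Schwarz the normalised moments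
  \<open>w \<bullet> B\<^sup>k w\<close> along \<open>k = 2\<^sup>j\<close> at least square at each step and hence explode, whereas
  the powers of a matrix of spectral radius less than \<open>1\<close> are bounded.
\<close>

lemma quadratic_form_le_if_spectral_radius_less_1:
  fixes B :: "real mat"
  assumes B: "B \<in> carrier_mat n n" and sym: "transpose_mat B = B" and w: "w \<in> carrier_vec n"
    and sr: "spectral_radius (map_mat complex_of_real B) < 1"
  shows "w \<bullet> (B *\<^sub>v w) \<le> w \<bullet> w"
proof (rule ccontr)
  assume contra: "\<not> ?thesis"
  let ?f = "(*\<^sub>v) B"
  have fc: "(?f ^^ k) u \<in> carrier_vec n" if "u \<in> carrier_vec n" for k u
    by (induction k) (use that B in auto)
  have adj: "u \<bullet> (?f ^^ k) v = (?f ^^ k) u \<bullet> v" if "u \<in> carrier_vec n" "v \<in> carrier_vec n" for k u v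
    using that
  proof (induction k arbitrary: u)
    case (Suc k)
    have "u \<bullet> (?f ^^ Suc k) v = ?f u \<bullet> (?f ^^ k) v"
      using scalar_prod_symmetric_mat[OF B sym Suc.prems(1) fc[OF Suc.prems(2), of k]] by simp
    also have "\<dots> = (?f ^^ k) (?f u) \<bullet> v" using Suc B by simp
    finally show ?case by (simp add: funpow_swap1)
  qed simp
  have "w \<noteq> 0\<^sub>v n" using contra B by auto
  then have ww: "w \<bullet> w > 0" using w scalar_prod_self_pos by blast
  \<comment> \<open>Dividing by \<open>w \<bullet> w\<close> absorbs the constant in Cauchy-Schwarz,
    which then reads \<open>(a k)\<^sup>2 \<le> a (2 * k)\<close>.\<close>
  define a where "a k = (w \<bullet> (?f ^^ k) w) / (w \<bullet> w)" for k
  have a1: "a 1 > 1" using contra ww by (simp add: a_def)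
  have sq: "(a k)\<^sup>2 \<le> a (2 * k)" for k
  proof -
    have "w \<bullet> (?f ^^ (2 * k)) w = (?f ^^ k) w \<bullet> (?f ^^ k) w"
      using adj[OF w fc[OF w, of k], of k] by (simp add: mult_2 funpow_add)
    moreover have "(w \<bullet> (?f ^^ k) w)\<^sup>2 \<le> (w \<bullet> w) * ((?f ^^ k) w \<bullet> (?f ^^ k) w)"
      by (rule Cauchy_Schwarz_vec[OF w fc[OF w]])
    ultimately show ?thesis
      using ww by (simp add: a_def power2_eq_square field_simps)
  qed
  have pow: "a 1 ^ (2 ^ j) \<le> a (2 ^ j)" for j
  proof (induction j)
    case (Suc j)
    have "a 1 ^ (2 ^ Suc j) = (a 1 ^ (2 ^ j))\<^sup>2" by (simp add: power_mult[symmetric] mult.commute)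
    also have "\<dots> \<le> (a (2 ^ j))\<^sup>2" using Suc a1 by (intro power_mono) auto
    also have "\<dots> \<le> a (2 ^ Suc j)" using sq[of "2 ^ j"] by simp
    finally show ?case .
  qed simp
  obtain C where C: "\<And>k. w \<bullet> (B ^\<^sub>m k *\<^sub>v w) \<le> C"
    using quadratic_form_pow_bounded[OF B w sr] by blast
  have bound: "a k \<le> C / (w \<bullet> w)" for k
    using C[of k] ww pow_mat_mult_vec[OF B w, of k] by (simp add: a_def divide_right_mono)
  obtain N where N: "C / (w \<bullet> w) < a 1 ^ N" using real_arch_pow[OF a1] by blast
  \<comment> \<open>Growth is controlled only at exponents that are powers of two;
    \<open>N \<le> 2 ^ N\<close> passes to such an exponent.\<close>
  also have "\<dots> \<le> a 1 ^ (2 ^ N)" using a1 by (intro power_increasing) (auto simp: less_imp_le)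
  also have "\<dots> \<le> C / (w \<bullet> w)" using pow[of N] bound[of "2 ^ N"] by linarith
  finally show False by simp
qed

text \<open>Scaling by \<open>1 / t\<close> gives radius below 1 only for \<open>t\<close> strictly
  above the spectral radius, so the bound is proved for all such \<open>t\<close> and then
  \<open>t\<close> decreases to the radius. This also covers radius zero.\<close>

lemma quadratic_form_le_spectral_radius:
  fixes A :: "real mat"
  assumes A: "A \<in> carrier_mat n n" and sym: "transpose_mat A = A" and w: "w \<in> carrier_vec n"
    and n: "n > 0"
  shows "w \<bullet> (A *\<^sub>v w) \<le> spectral_radius (map_mat complex_of_real A) * (w \<bullet> w)"
proof -
  let ?C = "map_mat complex_of_real A"
  let ?\<rho> = "spectral_radius ?C"
  have C: "?C \<in> carrier_mat n n" using A by simp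
  have rho: "?\<rho> \<ge> 0" using spectral_radius_mem_max(1)[OF C n] by auto
  have *: "w \<bullet> (A *\<^sub>v w) \<le> t * (w \<bullet> w)" if t: "t > ?\<rho>" for t
  proof -
    let ?B = "(1 / t) \<cdot>\<^sub>m A"
    have t0: "t > 0" using rho t by linarith
    have "map_mat complex_of_real ?B = complex_of_real (1 / t) \<cdot>\<^sub>m ?C"
      by (rule eq_matI) auto
    then have "spectral_radius (map_mat complex_of_real ?B) < 1"
      using spectral_radius_smult_less_1[OF C n t t0] by simp
    moreover have "transpose_mat ?B = ?B"
      using sym A by (metis transpose_smult_mat)
    ultimately have "w \<bullet> (?B *\<^sub>v w) \<le> w \<bullet> w"
      using A w by (intro quadratic_form_le_if_spectral_radius_less_1) auto
    moreover have "w \<bullet> (?B *\<^sub>v w) = (w \<bullet> (A *\<^sub>v w)) / t"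
      using A w by (simp add: smult_mat_mult_vec)
    ultimately show ?thesis using t0 by (simp add: field_simps)
  qed
  have "((\<lambda>t. t * (w \<bullet> w)) \<longlongrightarrow> ?\<rho> * (w \<bullet> w)) (at_right ?\<rho>)"
    by (intro tendsto_intros)
  then show ?thesis
    by (rule tendsto_lowerbound) (use * in \<open>auto simp: eventually_at_right_less eventually_at_filter\<close>)
qed

subsection \<open>Polynomial functions\<close>

lemma continuous_on_mono2: "continuous_on UNIV (mono2 e)"
  unfolding mono2_def case_prod_unfold by (intro continuous_intros)

lemma continuous_on_PP:
  assumes "p \<in> PP k"
  shows "continuous_on UNIV p"
  using assms unfolding PP_def
proof (induction rule: bifun.span_induct)
  case base
  show ?case
    by (auto simp: bifun.subspace_def scale_bifun_def zero_fun_def plus_fun_def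
        intro!: continuous_intros)
next
  case (step p)
  then show ?case using continuous_on_mono2 by auto
qed

lemma mono2_in_PP: "fst e + snd e \<le> k \<Longrightarrow> mono2 e \<in> PP k"
  unfolding PP_def by (rule bifun.span_base) (cases e, auto)

lemma scale_in_PP: "p \<in> PP k \<Longrightarrow> (\<lambda>z. c * p z) \<in> PP k"
  using bifun.span_scale[of p _ c] by (simp add: PP_def scale_bifun_def)

lemma add_in_PP: "p \<in> PP k \<Longrightarrow> r \<in> PP k \<Longrightarrow> (\<lambda>z. p z + r z) \<in> PP k"
  using bifun.span_add[of p _ r] by (simp add: PP_def plus_fun_def)

lemma zero_in_PP: "(\<lambda>z. 0) \<in> PP k"
  using bifun.span_zero by (simp add: PP_def zero_fun_def)

lemma sum_in_PP:
  assumes "\<And>i. i \<in> I \<Longrightarrow> p i \<in> PP k"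
  shows "(\<lambda>z. \<Sum>i\<in>I. p i z) \<in> PP k"
  using assms by (induction I rule: infinite_finite_induct) (auto intro: add_in_PP zero_in_PP)

lemma PP_mono: "k \<le> l \<Longrightarrow> PP k \<subseteq> PP l"
  unfolding PP_def by (rule bifun.span_mono) auto

text \<open>The preimage of the subspace \<open>PP l\<close> under a linear operator is a subspace,
  so checking the generating monomials suffices. It serves both products and reflections.\<close>

lemma PP_map_closed:
  assumes "p \<in> PP k"
    and T: "\<And>e. fst e + snd e \<le> k \<Longrightarrow> T (mono2 e) \<in> PP l"
    and lin: "T (\<lambda>z. 0) = (\<lambda>z. 0)" "\<And>c f. T (\<lambda>z. c * f z) = (\<lambda>z. c * T f z)"
      "\<And>f g. T (\<lambda>z. f z + g z) = (\<lambda>z. T f z + T g z)"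
  shows "T p \<in> PP l"
  using assms(1) unfolding PP_def[of k]
proof (induction rule: bifun.span_induct)
  case base
  show ?case
    using lin by (auto simp: bifun.subspace_def scale_bifun_def zero_fun_def plus_fun_def
        intro: zero_in_PP scale_in_PP add_in_PP)
next
  case (step p)
  then show ?case using T by auto
qed

text \<open>The product is bilinear: the left factor is reduced to a monomial first, then, with that
  monomial fixed, the right one.\<close>

lemma mult_in_PP:
  assumes "p \<in> PP k" "r \<in> PP l"
  shows "(\<lambda>z. p z * r z) \<in> PP (k + l)"
proof (rule PP_map_closed[OF assms(1), of "\<lambda>p z. p z * r z"])
  fix e :: "nat \<times> nat" assume e: "fst e + snd e \<le> k"
  show "(\<lambda>z. mono2 e z * r z) \<in> PP (k + l)"
  proof (rule PP_map_closed[OF assms(2), of "\<lambda>r z. mono2 e z * r z"])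
    fix e' :: "nat \<times> nat" assume "fst e' + snd e' \<le> l"
    moreover have "(\<lambda>z. mono2 e z * mono2 e' z) = mono2 (fst e + fst e', snd e + snd e')"
      by (auto simp: mono2_def fun_eq_iff power_add)
    ultimately show "(\<lambda>z. mono2 e z * mono2 e' z) \<in> PP (k + l)"
      using e by (simp add: mono2_in_PP)
  qed (auto simp: algebra_simps)
qed (auto simp: algebra_simps)

text \<open>The degree bound is \<open>k div 2 + k div 2 \<le> k\<close>; for odd \<open>k\<close>
  it is \<open>k - 1\<close>, whence the inclusion of \<open>PP\<close> spaces.\<close>

lemma square_in_PP_pos:
  assumes "q \<in> PP (k div 2)"
  shows "(\<lambda>z. (q z)\<^sup>2) \<in> PP_pos k"
  using subsetD[OF PP_mono mult_in_PP[OF assms assms], of k]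
  by (auto simp: PP_pos_def power2_eq_square)

lemma reflect_in_PP:
  assumes "p \<in> PP k"
  shows "(\<lambda>(x, y). p (a * x, b * y)) \<in> PP k"
proof (rule PP_map_closed[OF assms, of "\<lambda>p (x, y). p (a * x, b * y)"])
  fix e :: "nat \<times> nat" assume "fst e + snd e \<le> k"
  moreover have "(\<lambda>(x, y). mono2 e (a * x, b * y)) = (\<lambda>z. (a ^ fst e * b ^ snd e) * mono2 e z)"
    by (auto simp: mono2_def fun_eq_iff power_mult_distrib)
  ultimately show "(\<lambda>(x, y). mono2 e (a * x, b * y)) \<in> PP k"
    by (metis mono2_in_PP scale_in_PP)
qed auto

lemma symmetrisation_in_PP_sym:
  assumes "p \<in> PP k"
  shows "(\<lambda>(x, y). sym_avg p x y) \<in> PP_sym k"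
proof -
  let ?r = "\<lambda>a b (x, y). p (a * x, b * y)"
  have "(\<lambda>z. 1/4 * (((?r 1 1 z + ?r (-1) 1 z) + ?r 1 (-1) z) + ?r (-1) (-1) z)) \<in> PP k"
    by (intro scale_in_PP add_in_PP reflect_in_PP assms)
  also have "(\<lambda>z. 1/4 * (((?r 1 1 z + ?r (-1) 1 z) + ?r 1 (-1) z) + ?r (-1) (-1) z))
      = (\<lambda>(x, y). sym_avg p x y)"
    by (auto simp: sym_avg_def fun_eq_iff)
  finally show ?thesis by (auto simp: PP_sym_def sym_avg_def)
qed

subsection \<open>Averages\<close>

lemma Omega_cbox: "Omega = cbox (-1, -1) (1, 1)"
  by (auto simp: Omega_def cbox_Pair_eq)

lemma integrable_on_Omega:
  fixes f :: bifun
  assumes "continuous_on UNIV f"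
  shows "f integrable_on Omega"
  unfolding Omega_cbox using assms by (intro integrable_continuous) (auto intro: continuous_on_subset)

lemma continuous_on_slice:
  fixes f :: bifun
  assumes "continuous_on UNIV f"
  shows "continuous_on S (\<lambda>t. f (c, t))" "continuous_on S (\<lambda>t. f (t, c))"
  by (rule continuous_on_compose2[OF assms]; auto intro!: continuous_intros)+

lemma integrable_on_slice:
  fixes f :: bifun
  assumes "continuous_on UNIV f"
  shows "(\<lambda>t. f (c, t)) integrable_on {a..b}" "(\<lambda>t. f (t, c)) integrable_on {a..b}"
  using assms by (auto intro!: integrable_continuous_interval continuous_on_slice)

text \<open>Additivity of the integrals relies on integrability, which continuity supplies; all
  polynomials qualify. The predicate lets \<open>avg\<close> and \<open>avg_bd\<close> share the
  results on symmetrisation and Gram matrices.\<close>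

definition linear_on_continuous :: "(bifun \<Rightarrow> real) \<Rightarrow> bool" where
  "linear_on_continuous L \<longleftrightarrow>
     (\<forall>f g. continuous_on UNIV f \<longrightarrow> continuous_on UNIV g \<longrightarrow> L (\<lambda>z. f z + g z) = L f + L g) \<and>
     (\<forall>c f. continuous_on UNIV f \<longrightarrow> L (\<lambda>z. c * f z) = c * L f)"

lemma linear_on_continuous_avg: "linear_on_continuous avg"
  unfolding linear_on_continuous_def avg_def
  by (auto simp: Henstock_Kurzweil_Integration.integral_add integrable_on_Omega algebra_simps)

lemma linear_on_continuous_avg_x: "linear_on_continuous avg_x"
  unfolding linear_on_continuous_def
proof (intro conjI allI impI)
  fix f g :: bifun assume "continuous_on UNIV f" "continuous_on UNIV g"
  then show "avg_x (\<lambda>z. f z + g z) = avg_x f + avg_x g"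
    by (simp add: avg_x_def Henstock_Kurzweil_Integration.integral_add integrable_on_slice
        integrable_add algebra_simps)
next
  fix c :: real and f :: bifun
  show "avg_x (\<lambda>z. c * f z) = c * avg_x f"
    unfolding avg_x_def distrib_left[symmetric] by simp
qed

lemma linear_on_continuous_avg_y: "linear_on_continuous avg_y"
  unfolding linear_on_continuous_def
proof (intro conjI allI impI)
  fix f g :: bifun assume "continuous_on UNIV f" "continuous_on UNIV g"
  then show "avg_y (\<lambda>z. f z + g z) = avg_y f + avg_y g"
    by (simp add: avg_y_def Henstock_Kurzweil_Integration.integral_add integrable_on_slice
        integrable_add algebra_simps)
next
  fix c :: real and f :: bifun
  show "avg_y (\<lambda>z. c * f z) = c * avg_y f"
    unfolding avg_y_def distrib_left[symmetric] by simp
qed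

lemma linear_on_continuous_avg_bd: "linear_on_continuous (avg_bd \<theta>)"
  using linear_on_continuous_avg_x linear_on_continuous_avg_y
  unfolding linear_on_continuous_def avg_bd_def by (auto simp: algebra_simps)

lemma linear_on_continuous_sum:
  assumes "linear_on_continuous L" "finite I" "\<And>i. i \<in> I \<Longrightarrow> continuous_on UNIV (f i)"
  shows "L (\<lambda>z. \<Sum>i\<in>I. f i z) = (\<Sum>i\<in>I. L (f i))"
  using assms(2,3)
proof (induction I)
  case empty
  show ?case
    using assms(1)[unfolded linear_on_continuous_def, THEN conjunct2, rule_format, of "\<lambda>z. 0" 0]
    by simp
next
  case (insert i I)
  then show ?case using assms(1) unfolding linear_on_continuous_def
    by (simp add: continuous_on_sum)
qed

lemma avg_nonneg:
  assumes "continuous_on UNIV p" "\<And>z. z \<in> Omega \<Longrightarrow> p z \<ge> 0"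
  shows "avg p \<ge> 0"
  unfolding avg_def using assms
  by (intro mult_nonneg_nonneg Henstock_Kurzweil_Integration.integral_nonneg integrable_on_Omega) auto

text \<open>The edges of the square belong to \<open>Omega\<close>, and both
  \<open>1 + \<theta>\<close> and \<open>1 - \<theta>\<close> are nonnegative.\<close>

lemma avg_bd_nonneg:
  assumes "continuous_on UNIV p" "\<And>z. z \<in> Omega \<Longrightarrow> p z \<ge> 0" "\<theta> \<in> {-1..1}"
  shows "avg_bd \<theta> p \<ge> 0"
proof -
  have "avg_x p \<ge> 0" "avg_y p \<ge> 0"
    unfolding avg_x_def avg_y_def using assms
    by (intro mult_nonneg_nonneg Henstock_Kurzweil_Integration.integral_nonneg
        integrable_add integrable_on_slice; force simp: Omega_def)+
  then show ?thesis using assms(3) by (simp add: avg_bd_def)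
qed

lemma avg_iterated:
  assumes "continuous_on UNIV p"
  shows "avg p = 1/4 * integral {-1..1} (\<lambda>x. integral {-1..1} (\<lambda>y. p (x, y)))"
  unfolding avg_def Omega_cbox
  using integral_prod_continuous[of "-1::real" "-1::real" 1 1 p] assms
  by (simp add: continuous_on_subset)

section \<open>Reflections and the reduction to symmetric polynomials\<close>

lemma integral_reflect_symmetric:
  fixes f :: "real \<Rightarrow> real"
  shows "integral {-1..1} (\<lambda>t. f (- t)) = integral {-1..1} f"
  using Henstock_Kurzweil_Integration.integral_reflect_real[of 1 "-1" f] by simp

text \<open>By Fubini, a reflection in \<open>x\<close> acts on the outer integral and one in
  \<open>y\<close> on the inner integral.\<close>

lemma avg_reflect:
  assumes p: "continuous_on UNIV p"
  shows "avg (\<lambda>(x, y). p (- x, y)) = avg p" "avg (\<lambda>(x, y). p (x, - y)) = avg p"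
proof -
  have "continuous_on UNIV (\<lambda>(x, y). p (- x, y))" "continuous_on UNIV (\<lambda>(x, y). p (x, - y))"
    unfolding case_prod_unfold by (rule continuous_on_compose2[OF p]; auto intro!: continuous_intros)+
  then show "avg (\<lambda>(x, y). p (- x, y)) = avg p" "avg (\<lambda>(x, y). p (x, - y)) = avg p"
    using integral_reflect_symmetric[of "\<lambda>x. integral {-1..1} (\<lambda>y. p (x, y))"]
      integral_reflect_symmetric[of "\<lambda>y. p (x, y)" for x]
    by (simp_all add: avg_iterated p)
qed

lemma avg_x_reflect:
  "avg_x (\<lambda>(x, y). p (- x, y)) = avg_x p" "avg_x (\<lambda>(x, y). p (x, - y)) = avg_x p"
  using integral_reflect_symmetric[of "\<lambda>y. p (-1, y) + p (1, y)"]
  by (simp_all add: avg_x_def add.commute)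

lemma avg_y_reflect:
  "avg_y (\<lambda>(x, y). p (- x, y)) = avg_y p" "avg_y (\<lambda>(x, y). p (x, - y)) = avg_y p"
  using integral_reflect_symmetric[of "\<lambda>x. p (x, -1) + p (x, 1)"]
  by (simp_all add: avg_y_def add.commute)

lemma avg_bd_reflect:
  "avg_bd \<theta> (\<lambda>(x, y). p (- x, y)) = avg_bd \<theta> p" "avg_bd \<theta> (\<lambda>(x, y). p (x, - y)) = avg_bd \<theta> p"
  by (simp_all add: avg_bd_def avg_x_reflect avg_y_reflect)

text \<open>By linearity the value at the symmetrisation is the mean of the values at four reflected
  copies of \<open>p\<close>, all equal to \<open>L p\<close>.\<close>

lemma symmetrisation_invariant:
  assumes L: "linear_on_continuous L"
    and refl: "\<And>p. continuous_on UNIV p \<Longrightarrow> L (\<lambda>(x, y). p (- x, y)) = L p"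
      "\<And>p. continuous_on UNIV p \<Longrightarrow> L (\<lambda>(x, y). p (x, - y)) = L p"
    and p: "continuous_on UNIV p"
  shows "L (\<lambda>(x, y). sym_avg p x y) = L p"
proof -
  have c: "continuous_on UNIV (\<lambda>(x, y). p (- x, y))" "continuous_on UNIV (\<lambda>(x, y). p (x, - y))"
    "continuous_on UNIV (\<lambda>(x, y). p (- x, - y))"
    unfolding case_prod_unfold by (rule continuous_on_compose2[OF p]; auto intro!: continuous_intros)+
  \<comment> \<open>The point reflection is a reflection in \<open>x\<close> applied to the copy
    already reflected in \<open>y\<close>.\<close>
  have "L (\<lambda>(x, y). p (- x, - y)) = L p"
    using refl(1)[OF c(2)] refl(2)[OF p] by simp
  moreover have "(\<lambda>(x, y). sym_avg p x y) = (\<lambda>z. 1/4 * (((p z + (\<lambda>(x, y). p (- x, y)) z)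
      + (\<lambda>(x, y). p (x, - y)) z) + (\<lambda>(x, y). p (- x, - y)) z))"
    by (auto simp: fun_eq_iff sym_avg_def)
  moreover have "L (\<lambda>z. 1/4 * (((p z + (\<lambda>(x, y). p (- x, y)) z)
      + (\<lambda>(x, y). p (x, - y)) z) + (\<lambda>(x, y). p (- x, - y)) z))
    = 1/4 * (((L p + L (\<lambda>(x, y). p (- x, y))) + L (\<lambda>(x, y). p (x, - y))) + L (\<lambda>(x, y). p (- x, - y)))"
  proof -
    have add: "L (\<lambda>z. f z + g z) = L f + L g"
      if "continuous_on UNIV f" "continuous_on UNIV g" for f g
      using L that unfolding linear_on_continuous_def by blast
    have scale: "L (\<lambda>z. r * f z) = r * L f" if "continuous_on UNIV f" for r f
      using L that unfolding linear_on_continuous_def by blast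
    show ?thesis by (simp only: scale add continuous_on_add p c)
  qed
  ultimately show ?thesis using refl(1)[OF p] refl(2)[OF p] by simp
qed

lemma avg_symmetrisation:
  assumes "continuous_on UNIV p"
  shows "avg (\<lambda>(x, y). sym_avg p x y) = avg p"
  by (rule symmetrisation_invariant[OF linear_on_continuous_avg avg_reflect assms])

lemma avg_bd_symmetrisation:
  assumes "continuous_on UNIV p"
  shows "avg_bd \<theta> (\<lambda>(x, y). sym_avg p x y) = avg_bd \<theta> p"
  by (rule symmetrisation_invariant[OF linear_on_continuous_avg_bd avg_bd_reflect assms])

lemma sym_avg_symmetrisation: "sym_avg (\<lambda>(x, y). sym_avg p x y) a b = sym_avg p a b"
  by (simp add: sym_avg_def field_simps)

text \<open>Both sides are linear, so the identity passes from \<open>B\<close> to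
  \<open>PP_sym k\<close>. All functionals in it agree on \<open>p\<close> and on its
  symmetrisation, which carries it to \<open>PP k\<close>.\<close>

lemma CAD_identity_from_basis:
  assumes span: "bifun.span B = PP_sym k"
    and B: "\<And>p. p \<in> B \<Longrightarrow> avg p = w * avg_bd \<theta> p + (\<Sum>s\<in>I. \<omega> s * sym_avg p (x s) (y s))"
    and p: "p \<in> PP k"
  shows "avg p = w * avg_bd \<theta> p + (\<Sum>s\<in>I. \<omega> s * sym_avg p (x s) (y s))"
proof -
  \<comment> \<open>Continuity is carried through the span induction because linearity of the
    averages is available for continuous functions.\<close>
  define P where "P p \<longleftrightarrow> continuous_on UNIV p \<and>
    avg p = w * avg_bd \<theta> p + (\<Sum>s\<in>I. \<omega> s * sym_avg p (x s) (y s))" for p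
  have avg_lin: "avg (\<lambda>z. f z + h z) = avg f + avg h" "avg (\<lambda>z. c * f z) = c * avg f"
    "avg_bd \<theta> (\<lambda>z. f z + h z) = avg_bd \<theta> f + avg_bd \<theta> h" "avg_bd \<theta> (\<lambda>z. c * f z) = c * avg_bd \<theta> f"
    if "P f" "P h" for f h c
    using that linear_on_continuous_avg linear_on_continuous_avg_bd[of \<theta>]
    by (simp_all add: P_def linear_on_continuous_def)
  have node_lin: "sym_avg (\<lambda>z. f z + h z) a b = sym_avg f a b + sym_avg h a b"
    "sym_avg (\<lambda>z. c * f z) a b = c * sym_avg f a b" for f h c a b
    by (simp_all add: sym_avg_def algebra_simps)
  have scale: "P (\<lambda>z. c * f z)" if f: "P f" for c f
  proof -
    have "(\<Sum>s\<in>I. \<omega> s * (c * sym_avg f (x s) (y s))) = c * (\<Sum>s\<in>I. \<omega> s * sym_avg f (x s) (y s))"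
      by (simp add: sum_distrib_left mult.left_commute)
    moreover have "avg f = w * avg_bd \<theta> f + (\<Sum>s\<in>I. \<omega> s * sym_avg f (x s) (y s))"
      "continuous_on UNIV f" using f by (simp_all add: P_def)
    ultimately show ?thesis
      unfolding P_def avg_lin[OF f f] node_lin by (simp add: continuous_on_mult distrib_left mult.left_commute)
  qed
  have add: "P (\<lambda>z. f z + h z)" if f: "P f" and h: "P h" for f h
  proof -
    have "avg f = w * avg_bd \<theta> f + (\<Sum>s\<in>I. \<omega> s * sym_avg f (x s) (y s))"
      "avg h = w * avg_bd \<theta> h + (\<Sum>s\<in>I. \<omega> s * sym_avg h (x s) (y s))"
      "continuous_on UNIV f" "continuous_on UNIV h" using f h by (simp_all add: P_def)
    then show ?thesis
      unfolding P_def avg_lin[OF f h] node_lin by (simp add: continuous_on_add distrib_left sum.distrib)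
  qed
  have base: "P b" if "b \<in> B" for b
  proof -
    have "b \<in> PP k" using that span bifun.span_base by (auto simp: PP_sym_def)
    then show ?thesis using B that continuous_on_PP by (auto simp: P_def)
  qed
  have zero: "P (\<lambda>z. 0)"
    by (simp add: P_def avg_def avg_bd_def avg_x_def avg_y_def sym_avg_def)
  have "P r" if "r \<in> PP_sym k" for r
    using that unfolding span[symmetric]
  proof (induction rule: bifun.span_induct)
    case base
    show ?case using zero scale add
      by (auto simp: bifun.subspace_def scale_bifun_def zero_fun_def plus_fun_def)
  qed (rule base)
  from this[OF symmetrisation_in_PP_sym[OF p]] show ?thesis
    using continuous_on_PP[OF p]
    by (simp add: P_def avg_symmetrisation avg_bd_symmetrisation sym_avg_symmetrisation)
qed

subsection \<open>The eigenvector polynomial\<close>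

definition basis_vec :: "bifun list \<Rightarrow> real \<times> real \<Rightarrow> real Matrix.vec" where
  "basis_vec bs z = Matrix.vec (length bs) (\<lambda>i. (bs ! i) z)"

lemma basis_vec_carrier [simp]: "basis_vec bs z \<in> carrier_vec (length bs)"
  by (simp add: basis_vec_def)

lemma gram_mat_carrier [simp]: "gram_mat L bs \<in> carrier_mat (length bs) (length bs)"
  by (simp add: gram_mat_def)

lemma transpose_gram_mat: "transpose_mat (gram_mat L bs) = gram_mat L bs"
  by (rule eq_matI) (auto simp: gram_mat_def mult.commute)

text \<open>Thus the matrix \<open>M\<^sub>\<theta>\<close> is itself a Gram matrix, and both
  matrices in the eigenproblem are treated alike.\<close>

lemma gram_mat_avg_bd:
  "(1 + \<theta>) \<cdot>\<^sub>m gram_mat avg_x bs + (1 - \<theta>) \<cdot>\<^sub>m gram_mat avg_y bs = gram_mat (avg_bd \<theta>) bs"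
  by (rule eq_matI) (auto simp: gram_mat_def avg_bd_def)

text \<open>The bridge from quadratic forms to averages of squares: expand the square as a double
  sum and apply linearity termwise.\<close>

lemma scalar_prod_gram_mat:
  assumes L: "linear_on_continuous L" and cont: "\<And>b. b \<in> set bs \<Longrightarrow> continuous_on UNIV b"
    and u: "u \<in> carrier_vec (length bs)"
  shows "u \<bullet> (gram_mat L bs *\<^sub>v u) = L (\<lambda>z. (u \<bullet> basis_vec bs z)\<^sup>2)"
proof -
  let ?n = "length bs"
  let ?g = "\<lambda>i j z. (u $ i * u $ j) * ((bs ! i) z * (bs ! j) z)"
  have c: "continuous_on UNIV (bs ! i)" if "i < ?n" for i using cont that by simp
  have "(\<lambda>z. (u \<bullet> basis_vec bs z)\<^sup>2) = (\<lambda>z. \<Sum>i\<in>{0..<?n}. \<Sum>j\<in>{0..<?n}. ?g i j z)"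
    by (auto simp: fun_eq_iff basis_vec_def scalar_prod_def power2_eq_square sum_product
        intro!: sum.cong)
  then have "L (\<lambda>z. (u \<bullet> basis_vec bs z)\<^sup>2) = L (\<lambda>z. \<Sum>i\<in>{0..<?n}. \<Sum>j\<in>{0..<?n}. ?g i j z)"
    by simp
  also have "\<dots> = (\<Sum>i\<in>{0..<?n}. L (\<lambda>z. \<Sum>j\<in>{0..<?n}. ?g i j z))"
    by (intro linear_on_continuous_sum L) (auto intro!: continuous_intros c)
  also have "\<dots> = (\<Sum>i\<in>{0..<?n}. \<Sum>j\<in>{0..<?n}. L (?g i j))"
    by (intro sum.cong refl linear_on_continuous_sum L) (auto intro!: continuous_intros c)
  also have "\<dots> = (\<Sum>i\<in>{0..<?n}. \<Sum>j\<in>{0..<?n}. (u $ i * u $ j) * L (\<lambda>z. (bs ! i) z * (bs ! j) z))"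
    using L c by (intro sum.cong refl) (simp add: linear_on_continuous_def continuous_on_mult)
  also have "\<dots> = u \<bullet> (gram_mat L bs *\<^sub>v u)"
    using u by (auto simp: gram_mat_def scalar_prod_def sum_distrib_left intro!: sum.cong)
  finally show ?thesis ..
qed

lemma basis_combination_in_PP:
  assumes "set bs \<subseteq> PP m" "u \<in> carrier_vec (length bs)"
  shows "(\<lambda>z. u \<bullet> basis_vec bs z) \<in> PP m"
proof -
  have "(\<lambda>z. \<Sum>i\<in>{0..<length bs}. u $ i * (bs ! i) z) \<in> PP m"
    using assms(1) by (intro sum_in_PP scale_in_PP) (auto simp: subset_iff)
  then show ?thesis by (simp add: scalar_prod_def basis_vec_def)
qed

lemma PP_basis_combination:
  assumes bs: "set bs = mono2 ` {(i, j). i + j \<le> m}" and p: "p \<in> PP m"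
  obtains u where "u \<in> carrier_vec (length bs)" "p = (\<lambda>z. u \<bullet> basis_vec bs z)"
proof -
  let ?n = "length bs"
  have "\<exists>u\<in>carrier_vec ?n. p = (\<lambda>z. u \<bullet> basis_vec bs z)"
    using p unfolding PP_def bs[symmetric]
  proof (induction rule: bifun.span_induct)
    case base
    have "\<exists>u\<in>carrier_vec ?n. (\<lambda>z. 0) = (\<lambda>z. u \<bullet> basis_vec bs z)"
      by (rule bexI[of _ "0\<^sub>v ?n"]) auto
    moreover have "\<exists>w\<in>carrier_vec ?n. (\<lambda>z. u \<bullet> basis_vec bs z + v \<bullet> basis_vec bs z) = (\<lambda>z. w \<bullet> basis_vec bs z)"
      if "u \<in> carrier_vec ?n" "v \<in> carrier_vec ?n" for u v
      by (rule bexI[of _ "u + v"]) (use that in \<open>auto simp: add_scalar_prod_distrib[of _ ?n]\<close>)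
    moreover have "\<exists>w\<in>carrier_vec ?n. (\<lambda>z. c * (u \<bullet> basis_vec bs z)) = (\<lambda>z. w \<bullet> basis_vec bs z)"
      if "u \<in> carrier_vec ?n" for u c
      by (rule bexI[of _ "c \<cdot>\<^sub>v u"]) (use that in \<open>auto simp: smult_scalar_prod_distrib[of _ ?n]\<close>)
    ultimately show ?case
      by (auto simp: bifun.subspace_def scale_bifun_def zero_fun_def plus_fun_def)
  next
    case (step b)
    then obtain i where "i < ?n" "b = bs ! i" by (metis in_set_conv_nth)
    then show ?case
      by (intro bexI[of _ "unit_vec ?n i"])
        (auto simp: scalar_prod_left_unit[of _ ?n] basis_vec_def)
  qed
  then show ?thesis using that by blast
qed

text \<open>Writing coefficient vectors as \<open>R *\<^sub>v w\<close> turns the Gram matrix of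
  \<open>avg\<close> into the identity and that of \<open>avg_bd\<close> into \<open>A\<close>. The
  ratio of boundary to interior average is then a Rayleigh quotient of \<open>A\<close>, bounded by
  the spectral radius \<open>\<rho>\<close> and equal to it at the eigenvector.\<close>

lemma q_star_extremal:
  assumes q: "is_q_star \<theta> m q" and \<theta>: "\<theta> \<in> {-1..1}"
  obtains \<rho> where "\<rho> > 0" "q \<in> PP m" "avg (\<lambda>z. (q z)\<^sup>2) > 0"
    "avg_bd \<theta> (\<lambda>z. (q z)\<^sup>2) = \<rho> * avg (\<lambda>z. (q z)\<^sup>2)"
    "\<And>p. p \<in> PP m \<Longrightarrow> avg_bd \<theta> (\<lambda>z. (p z)\<^sup>2) \<le> \<rho> * avg (\<lambda>z. (p z)\<^sup>2)"
proof -
  obtain es bs R A v where es: "set es = {(i, j). i + j \<le> m}" and bs: "bs = map mono2 es"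
    and R: "is_inv_sqrt (length bs) (gram_mat avg bs) R"
    and A: "A = R * gram_mat (avg_bd \<theta>) bs * R"
    and v: "eigenvector A v (spectral_radius (map_mat complex_of_real A))"
    and qv: "q = (\<lambda>z. v \<bullet> (R *\<^sub>v basis_vec bs z))"
    using q unfolding is_q_star_def gram_mat_avg_bd basis_vec_def[symmetric] by blast
  define n where "n = length bs"
  define \<rho> where "\<rho> = spectral_radius (map_mat complex_of_real A)"
  let ?G = "gram_mat avg bs" and ?H = "gram_mat (avg_bd \<theta>) bs"
  have set_bs: "set bs = mono2 ` {(i, j). i + j \<le> m}" using es bs by simp
  have bs_PP: "set bs \<subseteq> PP m" using set_bs mono2_in_PP by auto
  have cont: "continuous_on UNIV b" if "b \<in> set bs" for b
    using that bs_PP continuous_on_PP by blast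
  \<comment> \<open>The constant monomial makes the matrices nonempty, as the spectral radius bound
    requires.\<close>
  have "mono2 (0, 0) \<in> set bs" using set_bs by auto
  then have n0: "n > 0" by (auto simp: n_def length_pos_if_in_set)
  have Rc: "R \<in> carrier_mat n n" and Rsym: "transpose_mat R = R"
    and RRG: "R * R * ?G = 1\<^sub>m n"
    using R by (auto simp: is_inv_sqrt_def pos_def_mat_def inverts_mat_def n_def)
  have Gc: "?G \<in> carrier_mat n n" and Hc: "?H \<in> carrier_mat n n" by (simp_all add: n_def)
  have Ac: "A \<in> carrier_mat n n" using A Rc Hc by simp
  have Asym: "transpose_mat A = A"
    unfolding A using transpose_mult[of "R * ?H" n n R n] transpose_mult[OF Rc Hc]
      assoc_mult_mat[OF Rc Hc Rc] Rc Hc by (simp add: Rsym transpose_gram_mat)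
  \<comment> \<open>A one-sided inverse of a square matrix is two-sided, so
    \<open>R * (R * ?G) = 1\<^sub>m n\<close> gives the product in the other order.\<close>
  have RGR: "R * ?G * R = 1\<^sub>m n"
    using mat_mult_left_right_inverse[OF Rc, of "R * ?G"] assoc_mult_mat[OF Rc Rc Gc] Rc Gc RRG
    by simp
  have avg_form: "avg (\<lambda>z. ((R *\<^sub>v w) \<bullet> basis_vec bs z)\<^sup>2) = w \<bullet> w"
    and bd_form: "avg_bd \<theta> (\<lambda>z. ((R *\<^sub>v w) \<bullet> basis_vec bs z)\<^sup>2) = w \<bullet> (A *\<^sub>v w)"
    if w: "w \<in> carrier_vec n" for w
  proof -
    have Rw: "R *\<^sub>v w \<in> carrier_vec n" using Rc w by simp
    have move: "(R *\<^sub>v w) \<bullet> (M *\<^sub>v (R *\<^sub>v w)) = w \<bullet> ((R * M * R) *\<^sub>v w)"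
      if M: "M \<in> carrier_mat n n" for M
    proof -
      have "(R * M * R) *\<^sub>v w = R *\<^sub>v (M *\<^sub>v (R *\<^sub>v w))"
        using assoc_mult_mat_vec[of "R * M" n n R n w] M Rc w by simp
      then show ?thesis
        using scalar_prod_symmetric_mat[OF Rc Rsym w, of "M *\<^sub>v (R *\<^sub>v w)"] M Rw by simp
    qed
    show "avg (\<lambda>z. ((R *\<^sub>v w) \<bullet> basis_vec bs z)\<^sup>2) = w \<bullet> w"
      using scalar_prod_gram_mat[OF linear_on_continuous_avg cont, where u = "R *\<^sub>v w"] Rw move[OF Gc] RGR w
      by (simp add: n_def)
    show "avg_bd \<theta> (\<lambda>z. ((R *\<^sub>v w) \<bullet> basis_vec bs z)\<^sup>2) = w \<bullet> (A *\<^sub>v w)"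
      using scalar_prod_gram_mat[OF linear_on_continuous_avg_bd cont, where u = "R *\<^sub>v w"] Rw move[OF Hc] A
      by (simp add: n_def)
  qed
  have bound: "avg_bd \<theta> (\<lambda>z. (p z)\<^sup>2) \<le> \<rho> * avg (\<lambda>z. (p z)\<^sup>2)" if p: "p \<in> PP m" for p
  proof -
    obtain u where u: "u \<in> carrier_vec n" "p = (\<lambda>z. u \<bullet> basis_vec bs z)"
      using PP_basis_combination[OF set_bs p] unfolding n_def by blast
    \<comment> \<open>Solves \<open>R *\<^sub>v w = u\<close>: by \<open>RRG\<close> the inverse of
      \<open>R\<close> is \<open>R * ?G\<close>.\<close>
    define w where "w = R *\<^sub>v (?G *\<^sub>v u)"
    have w: "w \<in> carrier_vec n" using Rc Gc u by (simp add: w_def)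
    have "R *\<^sub>v w = (R * R * ?G) *\<^sub>v u"
      using Rc Gc u by (simp add: w_def assoc_mult_mat_vec[of _ n n _ n])
    then have "R *\<^sub>v w = u" using RRG u by simp
    then show ?thesis
      using avg_form[OF w] bd_form[OF w] u
        quadratic_form_le_spectral_radius[OF Ac Asym w n0]
      by (simp add: \<rho>_def)
  qed
  have vc: "v \<in> carrier_vec n" and v0: "v \<noteq> 0\<^sub>v n" and Av: "A *\<^sub>v v = \<rho> \<cdot>\<^sub>v v"
    using v Ac by (auto simp: eigenvector_def \<rho>_def)
  \<comment> \<open>Symmetry of \<open>R\<close> moves it onto \<open>v\<close>, so the coefficient
    vector of \<open>q\<close> has the form treated above.\<close>
  have q': "q = (\<lambda>z. (R *\<^sub>v v) \<bullet> basis_vec bs z)"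
    unfolding qv using scalar_prod_symmetric_mat[OF Rc Rsym vc] by (simp add: n_def)
  \<comment> \<open>Testing the bound on the constant 1 gives
    \<open>2 \<le> \<rho> * avg (\<lambda>z. 1)\<close> with a nonnegative average, which forces
    \<open>\<rho> > 0\<close>.\<close>
  have "avg_bd \<theta> (\<lambda>z. 1) = 2"
    by (simp add: avg_bd_def avg_x_def avg_y_def)
  moreover have "avg_bd \<theta> (\<lambda>z. 1) \<le> \<rho> * avg (\<lambda>z. 1)"
    using bound[OF mono2_in_PP[of "(0, 0)"]] by (simp add: mono2_def case_prod_unfold)
  moreover have "avg (\<lambda>z. 1) \<ge> 0" by (rule avg_nonneg) auto
  ultimately have "\<rho> > 0"
    by (metis less_le_trans mult_nonpos_nonneg not_less zero_less_numeral)
  moreover have "q \<in> PP m"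
    unfolding q' using Rc vc by (intro basis_combination_in_PP[OF bs_PP]) (simp add: n_def)
  moreover have "avg (\<lambda>z. (q z)\<^sup>2) > 0"
    using avg_form[OF vc] scalar_prod_self_pos[OF vc v0] by (simp add: q')
  moreover have "avg_bd \<theta> (\<lambda>z. (q z)\<^sup>2) = \<rho> * avg (\<lambda>z. (q z)\<^sup>2)"
    using avg_form[OF vc] bd_form[OF vc] vc by (simp add: q' Av)
  ultimately show ?thesis using that bound by blast
qed

subsection \<open>Weak duality\<close>

lemma feasible_weight_le_phi_star_pos:
  assumes w: "w \<in> feasible_weights \<theta> k" and \<theta>: "\<theta> \<in> {-1..1}"
  shows "ereal w \<le> phi_star_pos \<theta> k"
  unfolding phi_star_pos_def
proof (rule INF_greatest)
  fix p assume p: "p \<in> PP_pos k"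
  then have pk: "p \<in> PP k" and nonneg: "\<And>z. z \<in> Omega \<Longrightarrow> p z \<ge> 0" by (auto simp: PP_pos_def)
  obtain S \<omega> x y where cad: "feasible_CAD \<theta> k w S \<omega> x y" using w by (auto simp: feasible_weights_def)
  have "(\<Sum>s = 1..S. \<omega> s * sym_avg p (x s) (y s)) \<ge> 0"
  proof (intro sum_nonneg mult_nonneg_nonneg)
    fix s assume "s \<in> {1..S}"
    then have s: "\<omega> s > 0" "x s \<in> {0..1}" "y s \<in> {0..1}" using cad by (auto simp: feasible_CAD_def)
    then show "\<omega> s \<ge> 0" by simp
    have "p (x s, y s) \<ge> 0" "p (- x s, y s) \<ge> 0" "p (x s, - y s) \<ge> 0" "p (- x s, - y s) \<ge> 0"
      using s by (auto intro!: nonneg simp: Omega_def)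
    then show "sym_avg p (x s) (y s) \<ge> 0" by (simp add: sym_avg_def)
  qed
  then have "avg p \<ge> w * avg_bd \<theta> p" using cad pk by (simp add: feasible_CAD_def)
  moreover have "avg_bd \<theta> p \<ge> 0" by (rule avg_bd_nonneg[OF continuous_on_PP[OF pk] nonneg \<theta>])
  ultimately show "ereal w \<le> phi \<theta> p" by (auto simp: phi_def pos_le_divide_eq)
qed

lemma phi_star_pos_le_phi_star_sq: "phi_star_pos \<theta> k \<le> phi_star_sq \<theta> (k div 2)"
  unfolding phi_star_sq_def
proof (rule INF_greatest)
  fix q assume "q \<in> PP (k div 2)"
  then show "phi_star_pos \<theta> k \<le> phi \<theta> (\<lambda>z. (q z)\<^sup>2)"
    unfolding phi_star_pos_def using INF_lower[of "\<lambda>z. (q z)\<^sup>2" "PP_pos k" "phi \<theta>"]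
    by (simp add: square_in_PP_pos)
qed

text \<open>The infimum is attained at \<open>q\<close> with value \<open>1 / \<rho>\<close>. Being
  finite and positive, it can serve as a real boundary weight.\<close>

lemma phi_star_sq_q_star:
  assumes q: "is_q_star \<theta> m q" and \<theta>: "\<theta> \<in> {-1..1}"
  shows "phi_star_sq \<theta> m = phi \<theta> (\<lambda>z. (q z)\<^sup>2)" "q \<in> PP m" "q \<noteq> (\<lambda>z. 0)"
    "\<bar>phi_star_sq \<theta> m\<bar> \<noteq> \<infinity>" "phi_star_sq \<theta> m > 0"
proof -
  obtain \<rho> where \<rho>: "\<rho> > 0" "q \<in> PP m" "avg (\<lambda>z. (q z)\<^sup>2) > 0"
    "avg_bd \<theta> (\<lambda>z. (q z)\<^sup>2) = \<rho> * avg (\<lambda>z. (q z)\<^sup>2)"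
    "\<And>p. p \<in> PP m \<Longrightarrow> avg_bd \<theta> (\<lambda>z. (p z)\<^sup>2) \<le> \<rho> * avg (\<lambda>z. (p z)\<^sup>2)"
    using q_star_extremal[OF q \<theta>] by blast
  have phi_q: "phi \<theta> (\<lambda>z. (q z)\<^sup>2) = ereal (1 / \<rho>)" using \<rho> by (simp add: phi_def)
  have "ereal (1 / \<rho>) \<le> phi \<theta> (\<lambda>z. (p z)\<^sup>2)" if p: "p \<in> PP m" for p
  proof -
    \<comment> \<open>The sign permits dividing the extremal inequality by this average when it is
      nonzero; otherwise \<open>phi\<close> is infinite.\<close>
    have "avg_bd \<theta> (\<lambda>z. (p z)\<^sup>2) \<ge> 0"
      by (rule avg_bd_nonneg[OF _ _ \<theta>]) (auto intro!: continuous_intros continuous_on_PP[OF p])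
    then show ?thesis using \<rho>(5)[OF p] \<rho>(1) by (auto simp: phi_def field_simps)
  qed
  then show eq: "phi_star_sq \<theta> m = phi \<theta> (\<lambda>z. (q z)\<^sup>2)"
    unfolding phi_star_sq_def
    by (intro antisym INF_lower[OF \<rho>(2)]) (simp add: phi_q INF_greatest)
  show "q \<in> PP m" by fact
  show "q \<noteq> (\<lambda>z. 0)" using \<rho>(3) by (auto simp: avg_def)
  show "\<bar>phi_star_sq \<theta> m\<bar> \<noteq> \<infinity>" "phi_star_sq \<theta> m > 0"
    using \<rho>(1) by (simp_all add: eq phi_q)
qed

section \<open>Optimality of the cubature identity\<close>

theorem theorem5p19:
  fixes k S :: nat and \<theta> :: real and q :: bifun and g :: "nat \<Rightarrow> bifun"
    and \<omega> x y :: "nat \<Rightarrow> real"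
  assumes "k \<ge> 1" and "\<theta> \<in> {-1..1}"
    and "is_q_star \<theta> (k div 2) q"
    and "inj_on g {1..bifun.dim (PP_sym k)}"
    and "bifun.independent (g ` {1..bifun.dim (PP_sym k)})"
    and "bifun.span (g ` {1..bifun.dim (PP_sym k)}) = PP_sym k"
    and "\<forall>s \<in> {1..S}. \<omega> s > 0 \<and> x s \<in> {0..1} \<and> y s \<in> {0..1}"
    and "\<forall>s \<in> {1..S}. q (x s, y s) = 0"
    and "\<forall>i \<in> {1..bifun.dim (PP_sym k)}.
           avg (g i) = real_of_ereal (phi_star_sq \<theta> (k div 2)) * avg_bd \<theta> (g i)
                     + (\<Sum>s = 1..S. \<omega> s * sym_avg (g i) (x s) (y s))"
  shows "is_OCAD \<theta> k (real_of_ereal (phi_star_sq \<theta> (k div 2))) S \<omega> x y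
    \<and> ereal (omega_star \<theta> k) = phi_star_pos \<theta> k
    \<and> phi_star_pos \<theta> k = phi_star_sq \<theta> (k div 2)
    \<and> phi_star_sq \<theta> (k div 2) = phi \<theta> (\<lambda>z. (q z)\<^sup>2)
    \<and> critical_pos_poly \<theta> k (\<lambda>z. (q z)\<^sup>2)"
proof -
  note qs = phi_star_sq_q_star[OF assms(3,2)]
  define w where "w = real_of_ereal (phi_star_sq \<theta> (k div 2))"
  have w: "phi_star_sq \<theta> (k div 2) = ereal w" using qs(4) by (simp add: w_def ereal_real)
  have "w > 0" using qs(5) w by simp
  moreover have "avg p = w * avg_bd \<theta> p + (\<Sum>s = 1..S. \<omega> s * sym_avg p (x s) (y s))"
    if "p \<in> PP k" for p
    by (rule CAD_identity_from_basis[OF assms(6) _ that]) (use assms(9) in \<open>auto simp: w_def\<close>)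
  ultimately have cad: "feasible_CAD \<theta> k w S \<omega> x y"
    using assms(7) by (simp add: feasible_CAD_def)
  then have w_feasible: "w \<in> feasible_weights \<theta> k" by (auto simp: feasible_weights_def)
  \<comment> \<open>Feasibility of \<open>w\<close> closes the chain: \<open>w\<close> is at most
    the infimum over nonnegative polynomials, which is at most the infimum over squares, and that is
    \<open>w\<close> again.\<close>
  have pos_eq_sq: "phi_star_pos \<theta> k = phi_star_sq \<theta> (k div 2)"
    using feasible_weight_le_phi_star_pos[OF w_feasible assms(2)] phi_star_pos_le_phi_star_sq[of \<theta> k]
    by (simp add: w)
  have w_max: "w' \<le> w" if "w' \<in> feasible_weights \<theta> k" for w'
    using feasible_weight_le_phi_star_pos[OF that assms(2)] by (simp add: pos_eq_sq w)
  \<comment> \<open>The greatest element exists because \<open>w\<close> is both feasible and an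
    upper bound for the feasible weights.\<close>
  have "omega_star \<theta> k = w"
    unfolding omega_star_def by (rule Greatest_equality) (use w_feasible w_max in auto)
  moreover have "is_OCAD \<theta> k w S \<omega> x y" using cad w_max by (simp add: is_OCAD_def)
  moreover have "critical_pos_poly \<theta> k (\<lambda>z. (q z)\<^sup>2)"
    using square_in_PP_pos[OF qs(2)] qs(1,3) pos_eq_sq
    by (auto simp: critical_pos_poly_def fun_eq_iff)
  ultimately show ?thesis using pos_eq_sq qs(1) w unfolding w_def[symmetric] by metis
qed

end
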